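(* Let $\mathcal{H}$ be a real Hilbert space and $\mathcal{D}\subset\mathcal{H}$ a dictionary with $\|g\|=1$ for all $g\in\mathcal{D}$. Let $f\in\mathcal{H}$, let $(f_k)_{k\ge 0}$ be any sequence of approximations generated by the orthogonal greedy algorithm (OGA) applied to $f$, and let $r_k=f-f_k$. Then for every $h\in\mathcal{L}_1$, $$\|r_N\|^2\le \|f-h\|^2+4\|h\|_{\mathcal{L}_1}^2N^{-1},\qquad N=1,2,\ldots,$$ and therefore $$\|r_N\|\le K(f,2N^{-1/2},\mathcal{H},\mathcal{L}_1)\le 2K(f,N^{-1/2},\mathcal{H},\mathcal{L}_1),\qquad N=1,2,\ldots.$$
   Context: A dictionary is any family of elements of $\mathcal{H}$; here all are normalized to $\|g\|=1$. $\mathcal{L}_1=\mathcal{L}_1(\mathcal{D})$ is the set of $f\in\mathcal{H}$ admitting an expansion $f=\sum_{g\in\mathcal{D}}c_g g$ with $\sum_g|c_g|<\infty$, with norm $\|f\|_{\mathcal{L}_1}=\inf\{\sum_{g}|c_g| : f=\sum_{g}c_g g\}$. OGA: set $f_0=0$, $r_0=f$, $V_0=\{0\}$. For $k\ge1$, given $r_{k-1}=f-f_{k-1}$, choose $g_k\in\mathcal{D}$ with $|\langle r_{k-1},g_k\rangle|=\max_{g\in\mathcal{D}}|\langle r_{k-1},g\rangle|$, put $V_k=\mathrm{Span}\{g_1,\dots,g_k\}$, let $f_k=P_kf$ be the orthogonal projection of $f$ onto $V_k$, and $r_k=f-f_k$. $K$-functional: for $t>0$, $K(f,t,\mathcal{H},\mathcal{L}_1)=\inf_{h\in\mathcal{L}_1}\{\|f-h\|+t\|h\|_{\mathcal{L}_1}\}$.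 *)

theory Defs
  imports "HOL-Analysis.Analysis"
begin

text \<open>
  The ambient Hilbert space is a type of sort \<open>{real_inner, complete_space}\<close>; a dictionary is a
  set of its elements.  The coefficients of an expansion over \<open>D\<close> form a total function whose
  values outside \<open>D\<close> are irrelevant.
\<close>

definition expansion :: "'a::{real_inner, complete_space} set \<Rightarrow> 'a \<Rightarrow> ('a \<Rightarrow> real) \<Rightarrow> bool" where
  "expansion D f c \<longleftrightarrow>
     (\<lambda>g. \<bar>c g\<bar>) summable_on D \<and> ((\<lambda>g. c g *\<^sub>R g) has_sum f) D"

definition L1 :: "'a::{real_inner, complete_space} set \<Rightarrow> 'a set" where
  "L1 D = {f. \<exists>c. expansion D f c}"

text \<open>Meaningful only for \<open>f \<in> L1 D\<close>; otherwise the infimum is over the empty set.\<close>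

definition L1_norm :: "'a::{real_inner, complete_space} set \<Rightarrow> 'a \<Rightarrow> real" where
  "L1_norm D f = Inf {(\<Sum>\<^sub>\<infinity>g\<in>D. \<bar>c g\<bar>) | c. expansion D f c}"

definition K_functional :: "'a::{real_inner, complete_space} set \<Rightarrow> 'a \<Rightarrow> real \<Rightarrow> real" where
  "K_functional D f t = (INF h\<in>L1 D. norm (f - h) + t * L1_norm D h)"

definition is_orthogonal_projection ::
    "'a::{real_inner, complete_space} set \<Rightarrow> 'a \<Rightarrow> 'a \<Rightarrow> bool" where
  "is_orthogonal_projection V f p \<longleftrightarrow> p \<in> V \<and> (\<forall>v\<in>V. orthogonal (f - p) v)"

text \<open>
  \<open>OGA D f F\<close>: the sequence \<open>F\<close> is a possible run of the orthogonal greedy algorithm on \<open>f\<close>.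
  The maximizing \<open>g k\<close> need not be unique, and it is part of the hypothesis that the maximum
  is attained at every step.  The value \<open>g 0\<close> is unused.
\<close>

definition OGA :: "'a::{real_inner, complete_space} set \<Rightarrow> 'a \<Rightarrow> (nat \<Rightarrow> 'a) \<Rightarrow> bool" where
  "OGA D f F \<longleftrightarrow> F 0 = 0 \<and>
     (\<exists>g. \<forall>k\<ge>1. g k \<in> D \<and>
        (\<forall>d\<in>D. \<bar>(f - F (k - 1)) \<bullet> d\<bar> \<le> \<bar>(f - F (k - 1)) \<bullet> g k\<bar>) \<and>
        is_orthogonal_projection (span (g ` {1..k})) f (F k))"

end

theory Submission
  imports Defs
begin

text \<open>
  Let \<open>M\<close> be the \<open>L1\<close>-norm of \<open>h\<close> and \<open>s\<close> the maximum of \<open>\<bar>r\<^sub>k \<bullet> g\<bar>\<close> over the dictionary.  Since \<open>r\<^sub>k\<close> is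
  orthogonal to \<open>f\<^sub>k\<close>, we have \<open>\<parallel>r\<^sub>k\<parallel>\<^sup>2 = r\<^sub>k \<bullet> (f - h) + r\<^sub>k \<bullet> h\<close>, and Cauchy--Schwarz with AM--GM bounds the
  gap \<open>a\<^sub>k = \<parallel>r\<^sub>k\<parallel>\<^sup>2 - \<parallel>f - h\<parallel>\<^sup>2\<close> by \<open>2 M s\<close>.  A greedy step decreases \<open>\<parallel>r\<^sub>k\<parallel>\<^sup>2\<close> by at least \<open>s\<^sup>2\<close>.  Hence
  \<open>a\<^sub>k\<^sub>+\<^sub>1 \<le> a\<^sub>k - (a\<^sub>k / 2M)\<^sup>2\<close> as long as \<open>a\<^sub>k\<close> is positive, which forces \<open>a\<^sub>N \<le> 4M\<^sup>2 / N\<close>.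
\<close>

lemma L1_norm_nonneg:
  assumes "h \<in> L1 D"
  shows "0 \<le> L1_norm D h"
  unfolding L1_norm_def
  using assms by (intro cInf_greatest) (auto simp: L1_def intro: infsum_nonneg)

text \<open>This makes the infimum in \<open>K_functional\<close> range over a nonempty set, even
  for an empty dictionary.\<close>

lemma zero_in_L1: "0 \<in> L1 D"
  unfolding L1_def expansion_def by (auto intro!: exI[of _ "\<lambda>_. 0"])

text \<open>Pairing an expansion of \<open>h\<close> with \<open>x\<close> term by term costs at
  most \<open>s\<close> per unit of coefficient mass; the infimum over expansions then gives the
  norm.\<close>

lemma inner_le_L1_norm:
  assumes h: "h \<in> L1 D"
    and bound: "\<And>g. g \<in> D \<Longrightarrow> \<bar>x \<bullet> g\<bar> \<le> s"
    and "0 \<le> s"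
  shows "x \<bullet> h \<le> s * L1_norm D h"
proof -
  have key: "x \<bullet> h \<le> s * (\<Sum>\<^sub>\<infinity>g\<in>D. \<bar>c g\<bar>)" if c: "expansion D h c" for c
  proof (rule has_sum_mono)
    show "((\<lambda>g. s * \<bar>c g\<bar>) has_sum s * (\<Sum>\<^sub>\<infinity>g\<in>D. \<bar>c g\<bar>)) D"
      using c unfolding expansion_def by (intro has_sum_cmult_right has_sum_infsum) auto
    show "((\<lambda>g. x \<bullet> (c g *\<^sub>R g)) has_sum x \<bullet> h) D"
      using c unfolding expansion_def
      by (intro has_sum_bounded_linear[OF bounded_linear_inner_right]) simp
  next
    fix g assume "g \<in> D"
    have "x \<bullet> (c g *\<^sub>R g) \<le> \<bar>c g\<bar> * \<bar>x \<bullet> g\<bar>"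
      by (metis abs_ge_self abs_mult inner_scaleR_right)
    also have "\<dots> \<le> \<bar>c g\<bar> * s"
      using bound[OF \<open>g \<in> D\<close>] by (intro mult_left_mono) auto
    finally show "x \<bullet> (c g *\<^sub>R g) \<le> s * \<bar>c g\<bar>" by (simp add: mult.commute)
  qed
  \<comment> \<open>Passing to the infimum goes through division by \<open>s\<close>. For
    \<open>s = 0\<close> a single expansion suffices, since \<open>key\<close> then reads
    \<open>x \<bullet> h \<le> 0\<close>.\<close>
  show ?thesis
  proof (cases "s = 0")
    case True
    then show ?thesis using key h by (auto simp: L1_def)
  next
    case False
    with \<open>0 \<le> s\<close> have "0 < s" by simp
    have "x \<bullet> h / s \<le> L1_norm D h"
      unfolding L1_norm_def
      using h key \<open>0 < s\<close> by (intro cInf_greatest) (auto simp: L1_def field_simps)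
    then show ?thesis
      using \<open>0 < s\<close> by (simp add: field_simps)
  qed
qed

lemma orthogonal_projection_norm_le:
  assumes "subspace V" and "is_orthogonal_projection V f p" and "v \<in> V"
  shows "norm (f - p) \<le> norm (f - v)"
proof -
  have "orthogonal (f - p) (p - v)"
    using assms by (simp add: is_orthogonal_projection_def subspace_diff)
  then have "(norm (f - v))\<^sup>2 = (norm (f - p))\<^sup>2 + (norm (p - v))\<^sup>2"
    using norm_add_Pythagorean[of "f - p" "p - v"] by simp
  then show ?thesis
    by (metis le_add_same_cancel1 norm_ge_zero power2_le_imp_le zero_le_power2)
qed

lemma norm_sq_diff_unit_component:
  fixes x g :: "'a::real_inner"
  assumes "norm g = 1"
  shows "(norm (x - (x \<bullet> g) *\<^sub>R g))\<^sup>2 = (norm x)\<^sup>2 - (x \<bullet> g)\<^sup>2"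
proof -
  have "g \<bullet> g = 1" "g \<bullet> x = x \<bullet> g"
    using assms by (simp_all add: dot_square_norm inner_commute)
  then show ?thesis
    unfolding power2_norm_eq_inner
    by (simp add: inner_diff_left inner_diff_right power2_eq_square)
qed

text \<open>A discrete analogue of \<open>a' = - a^2 / C\<close>, whose positive solutions stay
  below \<open>C / t\<close>.\<close>

lemma le_divide_of_quadratic_decrease:
  fixes a :: "nat \<Rightarrow> real"
  assumes decrease: "\<And>k. a (Suc k) \<le> a k"
    and quadratic: "\<And>k. 0 \<le> a k \<Longrightarrow> a (Suc k) \<le> a k - (a k)\<^sup>2 / C"
    and "0 < C" and "1 \<le> N"
  shows "a N \<le> C / real N"
  using \<open>1 \<le> N\<close>
proof (induction N rule: dec_induct)
  case base
  \<comment> \<open>Nothing bounds \<open>a 0\<close> from above, but if it exceeds \<open>C\<close>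
    the quadratic decrease overshoots and makes \<open>a 1\<close> at most 0.\<close>
  show ?case
  proof (cases "0 \<le> a 0 \<and> C < a 0")
    case True
    then have "a 0 * C \<le> (a 0)\<^sup>2"
      using \<open>0 < C\<close> by (simp add: power2_eq_square mult_left_mono)
    then have "a 0 \<le> (a 0)\<^sup>2 / C"
      using \<open>0 < C\<close> by (simp add: field_simps)
    with quadratic[of 0] True \<open>0 < C\<close> show ?thesis by simp
  next
    case False
    with decrease[of 0] \<open>0 < C\<close> show ?thesis by auto
  qed
next
  case (step n)
  define x where "x = a n"
  have n: "0 < real n" using step by simp
  show ?case
  proof (cases "x \<le> C / real (Suc n)")
    case True
    with decrease[of n] show ?thesis by (simp add: x_def)
  next
    case False
    then have lower: "C / real (Suc n) < x" by simp
    then have "0 < x"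
      using \<open>0 < C\<close> by (meson divide_pos_pos of_nat_0_less_iff order_less_trans zero_less_Suc)
    \<comment> \<open>In the product \<open>x * (1 - x / C)\<close> the lower bound on
      \<open>x\<close> controls the second factor and the induction hypothesis the first.\<close>
    have "1 - x / C \<le> 1 - 1 / real (Suc n)"
      using lower \<open>0 < C\<close> by (simp add: field_simps)
    then have "1 - x / C \<le> n / Suc n"
      by (simp add: field_simps)
    then have "x * (1 - x / C) \<le> x * (n / Suc n)"
      using \<open>0 < x\<close> by (intro mult_left_mono) auto
    also have "\<dots> \<le> C / n * (n / Suc n)"
      using step.IH by (intro mult_right_mono) (auto simp: x_def)
    also have "\<dots> = C / Suc n" using n by simp
    finally have "x - x\<^sup>2 / C \<le> C / Suc n"
      by (simp add: algebra_simps power2_eq_square)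
    with quadratic[of n] \<open>0 < x\<close> show ?thesis by (simp add: x_def)
  qed
qed

lemma OGA_residual_orthogonal:
  assumes "OGA D f F"
  shows "(f - F k) \<bullet> F k = 0"
proof (cases "k = 0")
  case True
  then show ?thesis using assms by (simp add: OGA_def)
next
  case False
  then show ?thesis
    using assms unfolding OGA_def is_orthogonal_projection_def orthogonal_def
    by (metis One_nat_def Suc_leI neq0_conv)
qed

text \<open>The next projection is at least as close to \<open>f\<close> as the competitor that adds
  to \<open>F k\<close> the component of the residual along the newly chosen unit vector, and
  removing that component lowers the squared norm by exactly \<open>s^2\<close>.\<close>

lemma OGA_step:
  assumes unit: "\<And>g. g \<in> D \<Longrightarrow> norm g = 1"
    and OGA: "OGA D f F"
  obtains s where "0 \<le> s" "\<And>d. d \<in> D \<Longrightarrow> \<bar>(f - F k) \<bullet> d\<bar> \<le> s"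
    "(norm (f - F (Suc k)))\<^sup>2 \<le> (norm (f - F k))\<^sup>2 - s\<^sup>2"
proof -
  obtain g where F0: "F 0 = 0"
    and g: "\<And>k. k \<ge> 1 \<Longrightarrow> g k \<in> D \<and>
        (\<forall>d\<in>D. \<bar>(f - F (k - 1)) \<bullet> d\<bar> \<le> \<bar>(f - F (k - 1)) \<bullet> g k\<bar>) \<and>
        is_orthogonal_projection (span (g ` {1..k})) f (F k)"
    using OGA unfolding OGA_def by blast
  define x e where "x = f - F k" and "e = g (Suc k)"
  let ?V = "span (g ` {1..Suc k})"
  have "F k \<in> span (g ` {1..k})"
  proof (cases "k = 0")
    case False
    then show ?thesis using g[of k] by (simp add: is_orthogonal_projection_def)
  qed (simp add: F0)
  then have "F k \<in> ?V"
    by (rule rev_subsetD) (intro span_mono image_mono, simp)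
  then have "F k + (x \<bullet> e) *\<^sub>R e \<in> ?V"
    unfolding e_def by (intro span_add span_scale span_base[of "g (Suc k)"]) simp_all
  then have "norm (f - F (Suc k)) \<le> norm (f - (F k + (x \<bullet> e) *\<^sub>R e))"
    using g[of "Suc k"] by (intro orthogonal_projection_norm_le[of ?V]) auto
  then have "(norm (f - F (Suc k)))\<^sup>2 \<le> (norm (x - (x \<bullet> e) *\<^sub>R e))\<^sup>2"
    by (intro power_mono) (auto simp: x_def algebra_simps)
  also have "\<dots> = (norm x)\<^sup>2 - \<bar>x \<bullet> e\<bar>\<^sup>2"
    using g[of "Suc k"] unit by (simp add: norm_sq_diff_unit_component e_def)
  finally show ?thesis
    using g[of "Suc k"] by (intro that[of "\<bar>x \<bullet> e\<bar>"]) (auto simp: x_def e_def)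
qed

lemma OGA_residual_bound:
  assumes unit: "\<And>g. g \<in> D \<Longrightarrow> norm g = 1"
    and OGA: "OGA D f F" and h: "h \<in> L1 D" and "1 \<le> N"
  shows "(norm (f - F N))\<^sup>2 \<le> (norm (f - h))\<^sup>2 + 4 * (L1_norm D h)\<^sup>2 / real N"
proof -
  define M where "M = L1_norm D h"
  have M: "0 \<le> M" unfolding M_def by (rule L1_norm_nonneg[OF h])
  define a where "a k = (norm (f - F k))\<^sup>2 - (norm (f - h))\<^sup>2" for k
  have gap: "a k \<le> 2 * M * s"
    if "0 \<le> s" "\<And>d. d \<in> D \<Longrightarrow> \<bar>(f - F k) \<bullet> d\<bar> \<le> s" for k s
  proof -
    let ?x = "f - F k"
    have "(norm ?x)\<^sup>2 = ?x \<bullet> (f - h) + ?x \<bullet> h"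
      using OGA_residual_orthogonal[OF OGA, of k]
      by (simp add: power2_norm_eq_inner inner_diff_right)
    also have "\<dots> \<le> norm ?x * norm (f - h) + s * M"
      unfolding M_def
      by (intro add_mono norm_cauchy_schwarz inner_le_L1_norm[OF h] that)
    \<comment> \<open>Half of the squared residual is absorbed on the left, which produces the
      factor 2 in \<open>gap\<close> and hence the 4 in the final bound.\<close>
    also have "norm ?x * norm (f - h) \<le> ((norm ?x)\<^sup>2 + (norm (f - h))\<^sup>2) / 2"
      using sum_squares_bound[of "norm ?x" "norm (f - h)"] by simp
    finally show ?thesis by (simp add: a_def field_simps)
  qed
  show ?thesis
  \<comment> \<open>The recursion is applied with \<open>C = 4 * M^2\<close>, which must be
    positive; for \<open>M = 0\<close> the gap bound alone gives \<open>a N \<le> 0\<close>.\<close>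
  proof (cases "M = 0")
    case True
    obtain s where "0 \<le> s" "\<And>d. d \<in> D \<Longrightarrow> \<bar>(f - F N) \<bullet> d\<bar> \<le> s"
      using OGA_step[OF unit OGA] by blast
    then have "a N \<le> 0" using gap True by fastforce
    then show ?thesis using True by (simp add: a_def M_def)
  next
    case False
    have "a N \<le> 4 * M\<^sup>2 / real N"
    proof (rule le_divide_of_quadratic_decrease)
      fix k
      obtain s where s: "0 \<le> s" "\<And>d. d \<in> D \<Longrightarrow> \<bar>(f - F k) \<bullet> d\<bar> \<le> s"
        and step: "(norm (f - F (Suc k)))\<^sup>2 \<le> (norm (f - F k))\<^sup>2 - s\<^sup>2"
        using OGA_step[OF unit OGA] by blast
      have step': "a (Suc k) \<le> a k - s\<^sup>2" using step by (simp add: a_def)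
      then show "a (Suc k) \<le> a k" by (smt (verit) zero_le_power2)
      assume "0 \<le> a k"
      then have "(a k)\<^sup>2 \<le> (2 * M * s)\<^sup>2"
        using gap[OF s] by (intro power_mono)
      then have "(a k)\<^sup>2 / (4 * M\<^sup>2) \<le> s\<^sup>2"
        using False by (simp add: pos_divide_le_eq power_mult_distrib mult.commute)
      with step' show "a (Suc k) \<le> a k - (a k)\<^sup>2 / (4 * M\<^sup>2)" by simp
    qed (use False \<open>1 \<le> N\<close> in auto)
    then show ?thesis by (simp add: a_def M_def)
  qed
qed

lemma K_functional_le:
  assumes "h \<in> L1 D" and "0 \<le> t"
  shows "K_functional D f t \<le> norm (f - h) + t * L1_norm D h"
  unfolding K_functional_def
  using assms by (intro cINF_lower bdd_belowI2[of _ 0]) (auto simp: L1_norm_nonneg)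

lemma K_functional_greatest:
  assumes "\<And>h. h \<in> L1 D \<Longrightarrow> b \<le> norm (f - h) + t * L1_norm D h"
  shows "b \<le> K_functional D f t"
  unfolding K_functional_def
  using assms zero_in_L1 by (intro cINF_greatest) auto

text \<open>Doubling both terms for a given \<open>h\<close> only increases the first one.\<close>

lemma K_functional_double_le:
  assumes "0 \<le> t"
  shows "K_functional D f (2 * t) \<le> 2 * K_functional D f t"
proof -
  have "K_functional D f (2 * t) / 2 \<le> K_functional D f t"
  proof (rule K_functional_greatest)
    fix h assume "h \<in> L1 D"
    then have "K_functional D f (2 * t) \<le> norm (f - h) + 2 * t * L1_norm D h"
      using assms by (intro K_functional_le) auto
    then show "K_functional D f (2 * t) / 2 \<le> norm (f - h) + t * L1_norm D h"
      using norm_ge_zero[of "f - h"] by argo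
  qed
  then show ?thesis by simp
qed

theorem theorem2p3:
  fixes D :: "'a::{real_inner, complete_space} set"
    and f :: 'a
    and F r :: "nat \<Rightarrow> 'a"
  assumes "\<And>g. g \<in> D \<Longrightarrow> norm g = 1"
    and "OGA D f F"
    and "\<And>k. r k = f - F k"
  shows "(\<forall>h\<in>L1 D. \<forall>N::nat. N \<ge> 1 \<longrightarrow>
            (norm (r N))\<^sup>2 \<le> (norm (f - h))\<^sup>2 + 4 * (L1_norm D h)\<^sup>2 / real N)
       \<and> (\<forall>N::nat. N \<ge> 1 \<longrightarrow>
            norm (r N) \<le> K_functional D f (2 * real N powr (-1/2)) \<and>
            K_functional D f (2 * real N powr (-1/2))
              \<le> 2 * K_functional D f (real N powr (-1/2)))"
proof (intro conjI ballI allI impI)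
  fix h and N :: nat assume "h \<in> L1 D" "N \<ge> 1"
  then show "(norm (r N))\<^sup>2 \<le> (norm (f - h))\<^sup>2 + 4 * (L1_norm D h)\<^sup>2 / real N"
    using OGA_residual_bound assms by metis
next
  fix N :: nat assume N: "N \<ge> 1"
  define t where "t = real N powr (-1/2)"
  have t_sq: "t\<^sup>2 = 1 / real N"
    using N by (simp add: t_def power2_eq_square powr_minus_divide flip: powr_add)
  have "0 \<le> t" by (simp add: t_def)
  have "norm (r N) \<le> K_functional D f (2 * t)"
  proof (rule K_functional_greatest)
    fix h assume h: "h \<in> L1 D"
    let ?M = "L1_norm D h"
    have "0 \<le> ?M" by (rule L1_norm_nonneg[OF h])
    have "(norm (r N))\<^sup>2 \<le> (norm (f - h))\<^sup>2 + 4 * ?M\<^sup>2 / real N"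
      using OGA_residual_bound[OF assms(1,2) h N] assms(3) by simp
    also have "\<dots> = (norm (f - h))\<^sup>2 + (2 * t * ?M)\<^sup>2"
      using t_sq by (simp add: power_mult_distrib)
    \<comment> \<open>The cross term of the square is nonnegative.\<close>
    also have "\<dots> \<le> (norm (f - h) + 2 * t * ?M)\<^sup>2"
      using \<open>0 \<le> t\<close> \<open>0 \<le> ?M\<close> by (simp add: power2_sum)
    finally show "norm (r N) \<le> norm (f - h) + 2 * t * ?M"
      by (rule power2_le_imp_le) (simp add: \<open>0 \<le> t\<close> \<open>0 \<le> ?M\<close>)
  qed
  then show "norm (r N) \<le> K_functional D f (2 * real N powr (-1/2))"
    by (simp add: t_def)
  show "K_functional D f (2 * real N powr (-1/2)) \<le> 2 * K_functional D f (real N powr (-1/2))"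
    by (rule K_functional_double_le) simp
qed

end
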